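(* Let $A$ be a nontrivial residuated lattice with lifting Boolean center. If $A$ is maximal, then $A$ is isomorphic to a finite direct product of local residuated lattices, each of which is a maximal residuated lattice.
   Context: A residuated lattice is a commutative integral residuated bounded lattice $(A,\vee,\wedge,\odot,\rightarrow,0,1)$: $(A,\vee,\wedge,0,1)$ is a bounded lattice, $(A,\odot,1)$ is a commutative monoid, and $a\le b\rightarrow c$ iff $a\odot b\le c$. It is nontrivial if $0\neq 1$. A filter of $A$ is a nonempty $F\subseteq A$ closed under $\odot$ and upward closed; it is proper if $F\ne A$; a maximal filter is a proper filter contained in no other proper filter. For a filter $F$, $a\equiv b \pmod F$ iff $(a\rightarrow b)\wedge(b\rightarrow a)\in F$; this is a congruence and $A/F$ is the quotient residuated lattice, $a/F$ the class of $a$. ${\rm Rad}(A)$ is the intersection of all maximal filters of $A$. $B(A)$ is the set of complemented elements of the lattice $(A,\vee,\wedge,0,1)$. $A$ has lifting Boolean center iff for every $e\in B(A/{\rm Rad}(A))$ there is $f\in B(A)$ with $e=f/{\rm Rad}(A)$. $A$ is maximal iff for every family $\{(a_i,F_i)\}_{i\in I}$ with $a_i\in A$ and $F_i$ filters of $A$ such that every finite $J\subseteq I$ admits $x_J\in A$ with $x_J\equiv a_i\pmod{F_i}$ for all $i\in J$, there exists $x\in A$ with $x\equiv a_i\pmod{F_i}$ for all $i\in I$. $A$ is local iff it has exactly one maximal filter. *)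

theory Defs
  imports "HOL-Algebra.Group"
begin

record 'a reslat = "'a monoid" +
  rl_join :: "'a \<Rightarrow> 'a \<Rightarrow> 'a" (infixl "\<curlyvee>\<index>" 65)
  rl_meet :: "'a \<Rightarrow> 'a \<Rightarrow> 'a" (infixl "\<curlywedge>\<index>" 70)
  rl_imp :: "'a \<Rightarrow> 'a \<Rightarrow> 'a" (infixr "\<rightharpoonup>\<index>" 60)
  rl_zero :: 'a ("\<zero>\<index>")

definition rl_le :: "'a reslat \<Rightarrow> 'a \<Rightarrow> 'a \<Rightarrow> bool" (infix "\<preceq>\<index>" 50)
  where "a \<preceq>\<^bsub>A\<^esub> b \<longleftrightarrow> a \<curlywedge>\<^bsub>A\<^esub> b = a"

text \<open>The lattice reduct is axiomatised equationally. Integrality is the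
  coincidence of the monoid unit with the top element.\<close>

locale residuated_lattice = comm_monoid A for A :: "'a reslat" (structure) +
  assumes join_closed: "\<lbrakk>a \<in> carrier A; b \<in> carrier A\<rbrakk> \<Longrightarrow> a \<curlyvee> b \<in> carrier A"
    and meet_closed: "\<lbrakk>a \<in> carrier A; b \<in> carrier A\<rbrakk> \<Longrightarrow> a \<curlywedge> b \<in> carrier A"
    and imp_closed: "\<lbrakk>a \<in> carrier A; b \<in> carrier A\<rbrakk> \<Longrightarrow> a \<rightharpoonup> b \<in> carrier A"
    and zero_closed: "\<zero> \<in> carrier A"
    and join_comm: "\<lbrakk>a \<in> carrier A; b \<in> carrier A\<rbrakk> \<Longrightarrow> a \<curlyvee> b = b \<curlyvee> a"
    and meet_comm: "\<lbrakk>a \<in> carrier A; b \<in> carrier A\<rbrakk> \<Longrightarrow> a \<curlywedge> b = b \<curlywedge> a"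
    and join_assoc: "\<lbrakk>a \<in> carrier A; b \<in> carrier A; c \<in> carrier A\<rbrakk>
          \<Longrightarrow> (a \<curlyvee> b) \<curlyvee> c = a \<curlyvee> (b \<curlyvee> c)"
    and meet_assoc: "\<lbrakk>a \<in> carrier A; b \<in> carrier A; c \<in> carrier A\<rbrakk>
          \<Longrightarrow> (a \<curlywedge> b) \<curlywedge> c = a \<curlywedge> (b \<curlywedge> c)"
    and join_meet_absorb: "\<lbrakk>a \<in> carrier A; b \<in> carrier A\<rbrakk> \<Longrightarrow> a \<curlyvee> (a \<curlywedge> b) = a"
    and meet_join_absorb: "\<lbrakk>a \<in> carrier A; b \<in> carrier A\<rbrakk> \<Longrightarrow> a \<curlywedge> (a \<curlyvee> b) = a"
    and zero_least: "a \<in> carrier A \<Longrightarrow> \<zero> \<preceq> a"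
    and one_greatest: "a \<in> carrier A \<Longrightarrow> a \<preceq> \<one>"
    and residuation: "\<lbrakk>a \<in> carrier A; b \<in> carrier A; c \<in> carrier A\<rbrakk>
          \<Longrightarrow> a \<preceq> b \<rightharpoonup> c \<longleftrightarrow> a \<otimes> b \<preceq> c"

definition rl_nontrivial :: "'a reslat \<Rightarrow> bool"
  where "rl_nontrivial A \<longleftrightarrow> \<zero>\<^bsub>A\<^esub> \<noteq> \<one>\<^bsub>A\<^esub>"

definition rl_filter :: "'a reslat \<Rightarrow> 'a set \<Rightarrow> bool"
  where "rl_filter A F \<longleftrightarrow> F \<subseteq> carrier A \<and> F \<noteq> {} \<and>
    (\<forall>a\<in>F. \<forall>b\<in>F. a \<otimes>\<^bsub>A\<^esub> b \<in> F) \<and>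
    (\<forall>a\<in>F. \<forall>b\<in>carrier A. a \<preceq>\<^bsub>A\<^esub> b \<longrightarrow> b \<in> F)"

definition rl_proper_filter :: "'a reslat \<Rightarrow> 'a set \<Rightarrow> bool"
  where "rl_proper_filter A F \<longleftrightarrow> rl_filter A F \<and> F \<noteq> carrier A"

definition rl_maximal_filter :: "'a reslat \<Rightarrow> 'a set \<Rightarrow> bool"
  where "rl_maximal_filter A M \<longleftrightarrow> rl_proper_filter A M \<and>
    (\<forall>F. rl_proper_filter A F \<and> M \<subseteq> F \<longrightarrow> F = M)"

definition rl_cong :: "'a reslat \<Rightarrow> 'a set \<Rightarrow> 'a \<Rightarrow> 'a \<Rightarrow> bool"
  where "rl_cong A F a b \<longleftrightarrow> (a \<rightharpoonup>\<^bsub>A\<^esub> b) \<curlywedge>\<^bsub>A\<^esub> (b \<rightharpoonup>\<^bsub>A\<^esub> a) \<in> F"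

definition rl_class :: "'a reslat \<Rightarrow> 'a set \<Rightarrow> 'a \<Rightarrow> 'a set"
  where "rl_class A F a = {b \<in> carrier A. rl_cong A F a b}"

text \<open>Since \<open>rl_cong A F\<close> is a congruence for a filter \<open>F\<close>, each union below is
  over copies of one and the same class, so for instance the product of the classes
  of \<open>a\<close> and \<open>b\<close> is the class of \<open>a \<otimes> b\<close>.\<close>

definition rl_quotient :: "'a reslat \<Rightarrow> 'a set \<Rightarrow> 'a set reslat"
  where "rl_quotient A F =
    \<lparr>carrier = rl_class A F ` carrier A,
     mult = (\<lambda>X Y. \<Union>x\<in>X. \<Union>y\<in>Y. rl_class A F (x \<otimes>\<^bsub>A\<^esub> y)),
     one = rl_class A F \<one>\<^bsub>A\<^esub>,
     rl_join = (\<lambda>X Y. \<Union>x\<in>X. \<Union>y\<in>Y. rl_class A F (x \<curlyvee>\<^bsub>A\<^esub> y)),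
     rl_meet = (\<lambda>X Y. \<Union>x\<in>X. \<Union>y\<in>Y. rl_class A F (x \<curlywedge>\<^bsub>A\<^esub> y)),
     rl_imp = (\<lambda>X Y. \<Union>x\<in>X. \<Union>y\<in>Y. rl_class A F (x \<rightharpoonup>\<^bsub>A\<^esub> y)),
     rl_zero = rl_class A F \<zero>\<^bsub>A\<^esub>\<rparr>"

text \<open>The intersection with the carrier only matters if there is no maximal filter,
  that is, if \<open>A\<close> is trivial.\<close>

definition rl_Rad :: "'a reslat \<Rightarrow> 'a set"
  where "rl_Rad A = carrier A \<inter> \<Inter>{M. rl_maximal_filter A M}"

definition rl_Boolean_center :: "'a reslat \<Rightarrow> 'a set"
  where "rl_Boolean_center A =
    {e \<in> carrier A. \<exists>g\<in>carrier A. e \<curlywedge>\<^bsub>A\<^esub> g = \<zero>\<^bsub>A\<^esub> \<and> e \<curlyvee>\<^bsub>A\<^esub> g = \<one>\<^bsub>A\<^esub>}"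

definition rl_lifting_Boolean_center :: "'a reslat \<Rightarrow> bool"
  where "rl_lifting_Boolean_center A \<longleftrightarrow>
    (\<forall>e\<in>rl_Boolean_center (rl_quotient A (rl_Rad A)).
      \<exists>f\<in>rl_Boolean_center A. e = rl_class A (rl_Rad A) f)"

text \<open>A definition cannot quantify over all index types. The index type
  \<open>'a \<times> 'a set\<close> can accommodate every family up to repetition of its members;
  \<open>rl_maximal_family\<close> below gives the property for families over any type.\<close>

definition rl_maximal :: "'a reslat \<Rightarrow> bool"
  where "rl_maximal A \<longleftrightarrow>
    (\<forall>(I :: ('a \<times> 'a set) set) a F.
      (\<forall>i\<in>I. a i \<in> carrier A \<and> rl_filter A (F i)) \<and>
      (\<forall>J. finite J \<and> J \<subseteq> I \<longrightarrow> (\<exists>x\<in>carrier A. \<forall>i\<in>J. rl_cong A (F i) x (a i)))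
      \<longrightarrow> (\<exists>x\<in>carrier A. \<forall>i\<in>I. rl_cong A (F i) x (a i)))"

lemma rl_maximal_family:
  fixes I :: "'i set" and a :: "'i \<Rightarrow> 'a" and F :: "'i \<Rightarrow> 'a set"
  assumes "rl_maximal A"
    and mem: "\<And>i. i \<in> I \<Longrightarrow> a i \<in> carrier A \<and> rl_filter A (F i)"
    and fin: "\<And>J. finite J \<Longrightarrow> J \<subseteq> I \<Longrightarrow> \<exists>x\<in>carrier A. \<forall>i\<in>J. rl_cong A (F i) x (a i)"
  shows "\<exists>x\<in>carrier A. \<forall>i\<in>I. rl_cong A (F i) x (a i)"
proof -
  let ?p = "\<lambda>i. (a i, F i)"
  have "\<exists>x\<in>carrier A. \<forall>q\<in>J. rl_cong A (snd q) x (fst q)"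
    if J: "finite J" "J \<subseteq> ?p ` I" for J
  proof -
    obtain K where "K \<subseteq> I" "finite K" "J = ?p ` K"
      using finite_subset_image[OF J] by blast
    then show ?thesis using fin[of K] by simp
  qed
  moreover have "\<forall>q\<in>?p ` I. fst q \<in> carrier A \<and> rl_filter A (snd q)"
    using mem by simp
  ultimately have "\<exists>x\<in>carrier A. \<forall>q\<in>?p ` I. rl_cong A (snd q) x (fst q)"
    using \<open>rl_maximal A\<close>[unfolded rl_maximal_def, rule_format, of "?p ` I" fst snd]
    by blast
  then show ?thesis by simp
qed

definition rl_local :: "'a reslat \<Rightarrow> bool"
  where "rl_local A \<longleftrightarrow> (\<exists>!M. rl_maximal_filter A M)"

definition rl_product :: "'i set \<Rightarrow> ('i \<Rightarrow> 'a reslat) \<Rightarrow> ('i \<Rightarrow> 'a) reslat"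
  where "rl_product I B =
    \<lparr>carrier = (\<Pi>\<^sub>E i\<in>I. carrier (B i)),
     mult = (\<lambda>f g. \<lambda>i\<in>I. f i \<otimes>\<^bsub>B i\<^esub> g i),
     one = (\<lambda>i\<in>I. \<one>\<^bsub>B i\<^esub>),
     rl_join = (\<lambda>f g. \<lambda>i\<in>I. f i \<curlyvee>\<^bsub>B i\<^esub> g i),
     rl_meet = (\<lambda>f g. \<lambda>i\<in>I. f i \<curlywedge>\<^bsub>B i\<^esub> g i),
     rl_imp = (\<lambda>f g. \<lambda>i\<in>I. f i \<rightharpoonup>\<^bsub>B i\<^esub> g i),
     rl_zero = (\<lambda>i\<in>I. \<zero>\<^bsub>B i\<^esub>)\<rparr>"

definition rl_iso :: "'a reslat \<Rightarrow> 'b reslat \<Rightarrow> ('a \<Rightarrow> 'b) set"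
  where "rl_iso A B = {h. bij_betw h (carrier A) (carrier B) \<and>
    h \<zero>\<^bsub>A\<^esub> = \<zero>\<^bsub>B\<^esub> \<and> h \<one>\<^bsub>A\<^esub> = \<one>\<^bsub>B\<^esub> \<and>
    (\<forall>a\<in>carrier A. \<forall>b\<in>carrier A.
      h (a \<curlyvee>\<^bsub>A\<^esub> b) = h a \<curlyvee>\<^bsub>B\<^esub> h b \<and>
      h (a \<curlywedge>\<^bsub>A\<^esub> b) = h a \<curlywedge>\<^bsub>B\<^esub> h b \<and>
      h (a \<otimes>\<^bsub>A\<^esub> b) = h a \<otimes>\<^bsub>B\<^esub> h b \<and>
      h (a \<rightharpoonup>\<^bsub>A\<^esub> b) = h a \<rightharpoonup>\<^bsub>B\<^esub> h b)}"

definition rl_isomorphic :: "'a reslat \<Rightarrow> 'b reslat \<Rightarrow> bool"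
  where "rl_isomorphic A B \<longleftrightarrow> rl_iso A B \<noteq> {}"

end

(* Distinct maximal filters are comaximal, so by the Chinese remainder theorem and maximality of A
   every maximal filter M is isolated by an element lying in M whose negation lies in all other
   maximal filters. This forces the maximal filters to be finitely many. Modulo the radical the
   isolating elements are complemented; lifting them to the Boolean center of A gives a finite
   partition of unity, since an idempotent lying in no maximal filter is 0. Hence A is the product
   of the intervals [0, e] below the members of the partition. The maximal filters of [0, e] come
   from those of A containing e, and systems of congruences in [0, e] pull back along a |-> a * e,
   so each interval is local and maximal. *)

theory Submission imports Defs begin

text \<open>The lattice reduct need not be distributive, so computations with joins go through
  \<open>\<otimes>\<close>, which residuation makes distribute over \<open>\<curlyvee>\<close>;
  multiplying by a Boolean element is the same as meeting with it. Accordingly, two congruences are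
  solved at once by \<open>(a \<otimes> k) \<curlyvee> (b \<otimes> l)\<close>, with
  \<open>k\<close> in one filter, \<open>l\<close> in the other and
  \<open>k \<otimes> l = \<zero>\<close>. An isolating element obtained from maximality need not be
  idempotent in \<open>A\<close>; this is the defect that the lifting hypothesis repairs. A lift is
  prescribed only modulo the radical, whereas a product decomposition needs disjointness and
  covering as exact equations. Idempotency bridges this gap: the principal up-set of a nonzero
  idempotent is a proper filter, so membership in maximal filters detects whether an idempotent
  vanishes. The factors are taken to be intervals instead of quotients because their elements then
  have the same type as those of \<open>A\<close>, as the conclusion requires.\<close>

context residuated_lattice
begin

section \<open>Order and residuation arithmetic\<close>

declare join_closed [simp, intro] meet_closed [simp, intro]
  imp_closed [simp, intro] zero_closed [simp, intro]
  zero_least [simp] one_greatest [simp]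

text \<open>Absorption used twice: \<open>a \<curlywedge> a = a \<curlywedge> (a \<curlyvee> (a
  \<curlywedge> a)) = a\<close>.\<close>

lemma meet_idem: "a \<in> carrier A \<Longrightarrow> a \<curlywedge> a = a"
  by (metis join_closed join_meet_absorb meet_join_absorb meet_closed)

lemma le_refl [simp]: "a \<in> carrier A \<Longrightarrow> a \<preceq> a"
  by (simp add: rl_le_def meet_idem)

lemma le_antisym: "\<lbrakk>a \<preceq> b; b \<preceq> a; a \<in> carrier A; b \<in> carrier A\<rbrakk> \<Longrightarrow> a = b"
  unfolding rl_le_def using meet_comm by metis

lemma le_trans: "\<lbrakk>a \<preceq> b; b \<preceq> c; a \<in> carrier A; b \<in> carrier A; c \<in> carrier A\<rbrakk> \<Longrightarrow> a \<preceq> c"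
  unfolding rl_le_def using meet_assoc by metis

lemma le_iff_join: "\<lbrakk>a \<in> carrier A; b \<in> carrier A\<rbrakk> \<Longrightarrow> a \<preceq> b \<longleftrightarrow> a \<curlyvee> b = b"
  unfolding rl_le_def by (metis join_meet_absorb meet_join_absorb meet_comm join_comm)

lemma meet_lower1 [simp]: "\<lbrakk>a \<in> carrier A; b \<in> carrier A\<rbrakk> \<Longrightarrow> a \<curlywedge> b \<preceq> a"
  unfolding rl_le_def using meet_assoc[of a a b] meet_comm[of "a \<curlywedge> b" a] by (simp add: meet_idem)

lemma meet_lower2 [simp]: "\<lbrakk>a \<in> carrier A; b \<in> carrier A\<rbrakk> \<Longrightarrow> a \<curlywedge> b \<preceq> b"
  by (metis meet_lower1 meet_comm)

lemma le_meet_iff [simp]: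
  "\<lbrakk>a \<in> carrier A; b \<in> carrier A; c \<in> carrier A\<rbrakk> \<Longrightarrow> c \<preceq> a \<curlywedge> b \<longleftrightarrow> c \<preceq> a \<and> c \<preceq> b"
  using le_trans[of c "a \<curlywedge> b" a] le_trans[of c "a \<curlywedge> b" b] meet_assoc[of c a b]
  by (auto simp: rl_le_def[of A c])

lemma join_upper1 [simp]: "\<lbrakk>a \<in> carrier A; b \<in> carrier A\<rbrakk> \<Longrightarrow> a \<preceq> a \<curlyvee> b"
  by (simp add: rl_le_def meet_join_absorb)

lemma join_upper2 [simp]: "\<lbrakk>a \<in> carrier A; b \<in> carrier A\<rbrakk> \<Longrightarrow> b \<preceq> a \<curlyvee> b"
  by (metis join_upper1 join_comm)

lemma join_le_iff [simp]:
  "\<lbrakk>a \<in> carrier A; b \<in> carrier A; c \<in> carrier A\<rbrakk> \<Longrightarrow> a \<curlyvee> b \<preceq> c \<longleftrightarrow> a \<preceq> c \<and> b \<preceq> c"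
  using le_trans[of a "a \<curlyvee> b" c] le_trans[of b "a \<curlyvee> b" c] join_assoc[of a b c]
  by (auto simp: le_iff_join[of _ c])

lemma join_zero [simp]:
  assumes "a \<in> carrier A"
  shows "a \<curlyvee> \<zero> = a" and "\<zero> \<curlyvee> a = a"
  using assms le_iff_join[of "\<zero>" a] by (simp_all add: join_comm[of a])

lemma le_zero_iff: "a \<in> carrier A \<Longrightarrow> a \<preceq> \<zero> \<longleftrightarrow> a = \<zero>"
  by (auto intro: le_antisym)

lemma one_le_iff: "a \<in> carrier A \<Longrightarrow> \<one> \<preceq> a \<longleftrightarrow> a = \<one>"
  by (auto intro: le_antisym)

text \<open>Monotonicity is not an axiom; it comes from the unit
  \<open>b \<preceq> c \<rightharpoonup> (b \<otimes> c)\<close> of the residuation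
  adjunction.\<close>

lemma mult_mono_left:
  assumes "a \<preceq> b" "a \<in> carrier A" "b \<in> carrier A" "c \<in> carrier A"
  shows "a \<otimes> c \<preceq> b \<otimes> c"
proof -
  have "b \<preceq> c \<rightharpoonup> (b \<otimes> c)"
    using assms by (simp add: residuation)
  then have "a \<preceq> c \<rightharpoonup> (b \<otimes> c)"
    using assms le_trans[of a b] by simp
  then show ?thesis using assms by (simp add: residuation)
qed

lemma mult_mono:
  assumes "a \<preceq> b" "c \<preceq> d" "a \<in> carrier A" "b \<in> carrier A" "c \<in> carrier A" "d \<in> carrier A"
  shows "a \<otimes> c \<preceq> b \<otimes> d"
proof -
  have "a \<otimes> c \<preceq> b \<otimes> c" using assms by (simp add: mult_mono_left)
  moreover have "b \<otimes> c \<preceq> b \<otimes> d"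
    using assms mult_mono_left[of c d b] by (simp add: m_comm)
  ultimately show ?thesis using assms le_trans by (meson m_closed)
qed

lemma mult_lower1 [simp]: "\<lbrakk>a \<in> carrier A; b \<in> carrier A\<rbrakk> \<Longrightarrow> a \<otimes> b \<preceq> a"
  using mult_mono[of a a b \<one>] by simp

lemma mult_lower2 [simp]: "\<lbrakk>a \<in> carrier A; b \<in> carrier A\<rbrakk> \<Longrightarrow> a \<otimes> b \<preceq> b"
  using mult_mono[of a \<one> b b] by simp

lemma mult_zero [simp]:
  assumes "a \<in> carrier A"
  shows "a \<otimes> \<zero> = \<zero>" and "\<zero> \<otimes> a = \<zero>"
  using assms mult_lower2[of a \<zero>] mult_lower1[of \<zero> a] by (simp_all add: le_zero_iff)

lemma mult_imp_le:
  assumes "a \<in> carrier A" "b \<in> carrier A"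
  shows "(a \<rightharpoonup> b) \<otimes> a \<preceq> b" and "a \<otimes> (a \<rightharpoonup> b) \<preceq> b"
  using assms residuation[of "a \<rightharpoonup> b" a b] by (simp_all add: m_comm)

lemma mult_neg [simp]:
  assumes "a \<in> carrier A"
  shows "a \<otimes> (a \<rightharpoonup> \<zero>) = \<zero>" and "(a \<rightharpoonup> \<zero>) \<otimes> a = \<zero>"
  using assms mult_imp_le[of a \<zero>] by (simp_all add: le_zero_iff)

text \<open>Multiplication by \<open>c\<close> is left adjoint to
  \<open>c \<rightharpoonup> _\<close>, and left adjoints preserve joins.\<close>

lemma mult_join_distrib:
  assumes "a \<in> carrier A" "b \<in> carrier A" "c \<in> carrier A"
  shows "(a \<curlyvee> b) \<otimes> c = (a \<otimes> c) \<curlyvee> (b \<otimes> c)"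
proof (rule le_antisym)
  have "a \<curlyvee> b \<preceq> c \<rightharpoonup> ((a \<otimes> c) \<curlyvee> (b \<otimes> c))"
    using assms by (simp add: residuation[of a] residuation[of b])
  then show "(a \<curlyvee> b) \<otimes> c \<preceq> (a \<otimes> c) \<curlyvee> (b \<otimes> c)"
    using assms residuation by (meson m_closed join_closed)
  show "(a \<otimes> c) \<curlyvee> (b \<otimes> c) \<preceq> (a \<curlyvee> b) \<otimes> c"
    using assms by (simp add: mult_mono_left)
qed (use assms in simp_all)

lemma mult_join_distrib2:
  "\<lbrakk>a \<in> carrier A; b \<in> carrier A; c \<in> carrier A\<rbrakk>
    \<Longrightarrow> c \<otimes> (a \<curlyvee> b) = (c \<otimes> a) \<curlyvee> (c \<otimes> b)"
  by (simp add: m_comm[of c] mult_join_distrib)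

subsection \<open>Filters and congruences\<close>

lemma filter_carrier: "\<lbrakk>rl_filter A F; a \<in> F\<rbrakk> \<Longrightarrow> a \<in> carrier A"
  by (auto simp: rl_filter_def)

lemma filter_mult: "\<lbrakk>rl_filter A F; a \<in> F; b \<in> F\<rbrakk> \<Longrightarrow> a \<otimes> b \<in> F"
  by (auto simp: rl_filter_def)

lemma filter_up: "\<lbrakk>rl_filter A F; a \<in> F; a \<preceq> b; b \<in> carrier A\<rbrakk> \<Longrightarrow> b \<in> F"
  by (auto simp: rl_filter_def)

lemma filter_one: "rl_filter A F \<Longrightarrow> \<one> \<in> F"
  by (auto simp: rl_filter_def)

lemma filterI:
  assumes "F \<subseteq> carrier A" "\<one> \<in> F"
    and "\<And>a b. a \<in> F \<Longrightarrow> b \<in> F \<Longrightarrow> a \<otimes> b \<in> F"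
    and "\<And>a b. a \<in> F \<Longrightarrow> b \<in> carrier A \<Longrightarrow> a \<preceq> b \<Longrightarrow> b \<in> F"
  shows "rl_filter A F"
  using assms unfolding rl_filter_def by blast

text \<open>Avoiding \<open>\<zero>\<close> is a condition that visibly survives unions of chains,
  as Zorn's lemma requires.\<close>

lemma proper_filter_iff: "rl_proper_filter A F \<longleftrightarrow> rl_filter A F \<and> \<zero> \<notin> F"
  unfolding rl_proper_filter_def
  by (metis filter_carrier filter_up subsetI subset_antisym zero_closed zero_least)

lemma maximal_filterD:
  assumes "rl_maximal_filter A M"
  shows "rl_filter A M" and "\<zero> \<notin> M"
  using assms by (auto simp: rl_maximal_filter_def proper_filter_iff)

lemma maximal_filter_neg:
  assumes "rl_maximal_filter A M" "a \<in> M" "a \<rightharpoonup> \<zero> \<in> M"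
  shows False
proof -
  note M = maximal_filterD[OF assms(1)]
  have "a \<otimes> (a \<rightharpoonup> \<zero>) \<in> M" using M assms filter_mult by blast
  then show False using M assms filter_carrier[of M a] by simp
qed

lemma maximal_filter_exists:
  assumes "rl_proper_filter A F"
  obtains M where "rl_maximal_filter A M" "F \<subseteq> M"
proof -
  let ?S = "{G. rl_proper_filter A G \<and> F \<subseteq> G}"
  have "\<exists>M\<in>?S. \<forall>X\<in>?S. M \<subseteq> X \<longrightarrow> X = M"
  proof (rule subset_Zorn_nonempty)
    show "?S \<noteq> {}" using assms by blast
    fix C assume C: "C \<noteq> {}" "subset.chain ?S C"
    then have G: "\<And>G. G \<in> C \<Longrightarrow> rl_filter A G \<and> \<zero> \<notin> G \<and> F \<subseteq> G"
      unfolding subset.chain_def by (auto simp: proper_filter_iff)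
    have "rl_filter A (\<Union>C)"
    proof (rule filterI)
      show "\<Union>C \<subseteq> carrier A" using G filter_carrier by blast
      show "\<one> \<in> \<Union>C" using C G filter_one by blast
    next
      fix a b assume "a \<in> \<Union>C" "b \<in> \<Union>C"
      then obtain G H where "a \<in> G" "G \<in> C" "b \<in> H" "H \<in> C" by blast
      moreover have "G \<subseteq> H \<or> H \<subseteq> G"
        using C(2) calculation unfolding subset.chain_def by blast
      ultimately show "a \<otimes> b \<in> \<Union>C"
        using G filter_mult by (metis UnionI in_mono)
    next
      fix a b assume "a \<in> \<Union>C" "b \<in> carrier A" "a \<preceq> b"
      then show "b \<in> \<Union>C" using G filter_up by (metis Union_iff)
    qed
    then show "\<Union>C \<in> ?S" using C(1) G by (auto simp: proper_filter_iff)
  qed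
  then obtain M where M: "rl_proper_filter A M" "F \<subseteq> M"
    and max: "\<And>X. rl_proper_filter A X \<Longrightarrow> F \<subseteq> X \<Longrightarrow> M \<subseteq> X \<Longrightarrow> X = M" by auto
  have "rl_maximal_filter A M"
    unfolding rl_maximal_filter_def using M max by (meson subset_trans)
  then show ?thesis using that M(2) by blast
qed

text \<open>The set \<open>?G\<close> is the filter generated by \<open>M\<close> and
  \<open>N\<close>. A proper filter above two distinct maximal ones cannot exist, so
  \<open>\<zero>\<close> is in \<open>?G\<close>; then
  \<open>m \<otimes> n \<preceq> \<zero>\<close>, which by residuation puts the negation of
  \<open>m\<close> above \<open>n\<close>.\<close>

lemma maximal_filters_comaximal:
  assumes M: "rl_maximal_filter A M" and N: "rl_maximal_filter A N" and "M \<noteq> N"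
  shows "\<exists>m\<in>M. m \<rightharpoonup> \<zero> \<in> N"
proof -
  note FM = maximal_filterD(1)[OF M] and FN = maximal_filterD(1)[OF N]
  let ?G = "{x \<in> carrier A. \<exists>m\<in>M. \<exists>n\<in>N. m \<otimes> n \<preceq> x}"
  have G: "rl_filter A ?G"
  proof (rule filterI)
    show "\<one> \<in> ?G"
      using filter_one[OF FM] filter_one[OF FN] by force
  next
    fix a b assume "a \<in> ?G" "b \<in> ?G"
    then obtain m n m' n' where *: "a \<in> carrier A" "b \<in> carrier A"
      "m \<in> M" "n \<in> N" "m \<otimes> n \<preceq> a" "m' \<in> M" "n' \<in> N" "m' \<otimes> n' \<preceq> b"
      by auto
    then have c: "m \<in> carrier A" "n \<in> carrier A" "m' \<in> carrier A" "n' \<in> carrier A"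
      using filter_carrier FM FN by blast+
    then have "(m \<otimes> n) \<otimes> (m' \<otimes> n') \<preceq> a \<otimes> b"
      using * by (simp add: mult_mono)
    moreover have "(m \<otimes> n) \<otimes> (m' \<otimes> n') = (m \<otimes> m') \<otimes> (n \<otimes> n')"
      using c by (simp add: m_ac)
    ultimately have "(m \<otimes> m') \<otimes> (n \<otimes> n') \<preceq> a \<otimes> b" by simp
    moreover have "m \<otimes> m' \<in> M" "n \<otimes> n' \<in> N" using * filter_mult FM FN by auto
    ultimately show "a \<otimes> b \<in> ?G" using *(1,2) by auto
  next
    fix a b assume "a \<in> ?G" "b \<in> carrier A" "a \<preceq> b"
    then show "b \<in> ?G"
      by (smt (verit) FM FN filter_carrier le_trans m_closed mem_Collect_eq)
  qed auto
  have MG: "M \<subseteq> ?G"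
  proof
    fix m assume "m \<in> M"
    then show "m \<in> ?G"
      using filter_carrier[OF FM, of m] filter_one[OF FN] mult_lower1[of m "\<one>"] by blast
  qed
  have NG: "N \<subseteq> ?G"
  proof
    fix n assume "n \<in> N"
    then show "n \<in> ?G"
      using filter_carrier[OF FN, of n] filter_one[OF FM] mult_lower2[of "\<one>" n] by blast
  qed
  have "\<not> rl_proper_filter A ?G"
  proof
    assume P: "rl_proper_filter A ?G"
    have "?G = M" using M P MG unfolding rl_maximal_filter_def by blast
    moreover have "?G = N" using N P NG unfolding rl_maximal_filter_def by blast
    ultimately show False using \<open>M \<noteq> N\<close> by simp
  qed
  then have "\<zero> \<in> ?G" using G proper_filter_iff by blast
  then obtain m n where mn: "m \<in> M" "n \<in> N" "m \<otimes> n \<preceq> \<zero>" by auto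
  then have c: "m \<in> carrier A" "n \<in> carrier A" using filter_carrier FM FN by blast+
  then have "n \<preceq> m \<rightharpoonup> \<zero>" using mn by (simp add: residuation m_comm)
  then show ?thesis using mn c FN filter_up by blast
qed

text \<open>Trades implications for products with a single witness from the filter, so that closure
  properties of congruence become computations in an ordered monoid.\<close>

lemma cong_iff:
  assumes F: "rl_filter A F" and "a \<in> carrier A" "b \<in> carrier A"
  shows "rl_cong A F a b \<longleftrightarrow> (\<exists>f\<in>F. f \<otimes> a \<preceq> b \<and> f \<otimes> b \<preceq> a)"
proof
  assume "rl_cong A F a b"
  then have "(a \<rightharpoonup> b) \<curlywedge> (b \<rightharpoonup> a) \<in> F" by (simp add: rl_cong_def)
  moreover have "(a \<rightharpoonup> b) \<curlywedge> (b \<rightharpoonup> a) \<preceq> a \<rightharpoonup> b" "(a \<rightharpoonup> b) \<curlywedge> (b \<rightharpoonup> a) \<preceq> b \<rightharpoonup> a"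
    using assms by simp_all
  ultimately show "\<exists>f\<in>F. f \<otimes> a \<preceq> b \<and> f \<otimes> b \<preceq> a"
    using assms residuation by (meson imp_closed meet_closed)
next
  assume "\<exists>f\<in>F. f \<otimes> a \<preceq> b \<and> f \<otimes> b \<preceq> a"
  then obtain f where f: "f \<in> F" "f \<otimes> a \<preceq> b" "f \<otimes> b \<preceq> a" by blast
  then have "f \<preceq> (a \<rightharpoonup> b) \<curlywedge> (b \<rightharpoonup> a)"
    using assms filter_carrier[OF F] by (simp add: residuation)
  then show "rl_cong A F a b"
    unfolding rl_cong_def using assms f filter_up by blast
qed

lemma cong_refl: "\<lbrakk>rl_filter A F; a \<in> carrier A\<rbrakk> \<Longrightarrow> rl_cong A F a a"
  using filter_one[of F] by (force simp: cong_iff)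

lemma cong_sym: "\<lbrakk>rl_filter A F; rl_cong A F a b; a \<in> carrier A; b \<in> carrier A\<rbrakk> \<Longrightarrow> rl_cong A F b a"
  by (auto simp: cong_iff)

lemma cong_trans:
  assumes F: "rl_filter A F" and ab: "rl_cong A F a b" and bc: "rl_cong A F b c"
    and c: "a \<in> carrier A" "b \<in> carrier A" "c \<in> carrier A"
  shows "rl_cong A F a c"
proof -
  obtain f where f: "f \<in> F" "f \<otimes> a \<preceq> b" "f \<otimes> b \<preceq> a" using ab c cong_iff[OF F] by blast
  obtain g where g: "g \<in> F" "g \<otimes> b \<preceq> c" "g \<otimes> c \<preceq> b" using bc c cong_iff[OF F] by blast
  have fg: "f \<in> carrier A" "g \<in> carrier A" using f g filter_carrier[OF F] by auto
  have "g \<otimes> (f \<otimes> a) \<preceq> g \<otimes> b" "f \<otimes> (g \<otimes> c) \<preceq> f \<otimes> b"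
    using f g c fg by (simp_all add: mult_mono)
  then have "g \<otimes> (f \<otimes> a) \<preceq> c" "f \<otimes> (g \<otimes> c) \<preceq> a"
    using f g c fg le_trans by (meson m_closed)+
  then have "(f \<otimes> g) \<otimes> a \<preceq> c" "(f \<otimes> g) \<otimes> c \<preceq> a"
    using c fg by (simp_all add: m_ac)
  then show ?thesis using f g c F filter_mult by (auto simp: cong_iff)
qed

text \<open>The product \<open>f \<otimes> g\<close> of the two witnesses lies below both, so it can
  act as either one on each argument. Meet and join are the operations in which complements of a
  quotient are expressed.\<close>

lemma
  assumes F: "rl_filter A F" and ab: "rl_cong A F a b" and cd: "rl_cong A F c d"
    and c: "a \<in> carrier A" "b \<in> carrier A" "c \<in> carrier A" "d \<in> carrier A"
  shows cong_meet: "rl_cong A F (a \<curlywedge> c) (b \<curlywedge> d)"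
    and cong_join: "rl_cong A F (a \<curlyvee> c) (b \<curlyvee> d)"
proof -
  obtain f where f: "f \<in> F" "f \<otimes> a \<preceq> b" "f \<otimes> b \<preceq> a" using ab c cong_iff[OF F] by blast
  obtain g where g: "g \<in> F" "g \<otimes> c \<preceq> d" "g \<otimes> d \<preceq> c" using cd c cong_iff[OF F] by blast
  have fg: "f \<in> carrier A" "g \<in> carrier A" using f g filter_carrier[OF F] by auto
  have L: "(f \<otimes> g) \<otimes> z \<preceq> y"
    if "z \<in> carrier A" "x \<in> carrier A" "y \<in> carrier A" "z \<preceq> x" "f \<otimes> x \<preceq> y" for x y z
    using that fg mult_mono[of "f \<otimes> g" f z x] le_trans[of "(f \<otimes> g) \<otimes> z" "f \<otimes> x" y] by simp
  have R: "(f \<otimes> g) \<otimes> z \<preceq> y"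
    if "z \<in> carrier A" "x \<in> carrier A" "y \<in> carrier A" "z \<preceq> x" "g \<otimes> x \<preceq> y" for x y z
    using that fg mult_mono[of "f \<otimes> g" g z x] le_trans[of "(f \<otimes> g) \<otimes> z" "g \<otimes> x" y] by simp
  have "(f \<otimes> g) \<otimes> (a \<curlywedge> c) \<preceq> b \<curlywedge> d" "(f \<otimes> g) \<otimes> (b \<curlywedge> d) \<preceq> a \<curlywedge> c"
    using L[of "a \<curlywedge> c" a b] R[of "a \<curlywedge> c" c d] L[of "b \<curlywedge> d" b a] R[of "b \<curlywedge> d" d c] c fg f g
    by simp_all
  then show "rl_cong A F (a \<curlywedge> c) (b \<curlywedge> d)"
    using filter_mult[OF F f(1) g(1)] c F by (auto simp: cong_iff)
  have *: "x \<preceq> y \<curlyvee> z" if "x \<preceq> y \<or> x \<preceq> z" "x \<in> carrier A" "y \<in> carrier A" "z \<in> carrier A" for x y z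
    using that le_trans[of x y "y \<curlyvee> z"] le_trans[of x z "y \<curlyvee> z"] by auto
  have "(f \<otimes> g) \<otimes> (a \<curlyvee> c) \<preceq> b \<curlyvee> d" "(f \<otimes> g) \<otimes> (b \<curlyvee> d) \<preceq> a \<curlyvee> c"
    using L[of a a b] R[of c c d] L[of b b a] R[of d d c] c fg f g
    by (simp_all add: mult_join_distrib2 *)
  then show "rl_cong A F (a \<curlyvee> c) (b \<curlyvee> d)"
    using filter_mult[OF F f(1) g(1)] c F by (auto simp: cong_iff)
qed

lemma cong_one_iff:
  assumes "rl_filter A F" "a \<in> carrier A"
  shows "rl_cong A F a \<one> \<longleftrightarrow> a \<in> F"
  using assms filter_carrier[of F] filter_up[of F _ a] by (force simp: cong_iff)

lemma cong_zero_iff: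
  assumes "rl_filter A F" "a \<in> carrier A"
  shows "rl_cong A F a \<zero> \<longleftrightarrow> a \<rightharpoonup> \<zero> \<in> F"
proof
  assume "rl_cong A F a \<zero>"
  then obtain f where "f \<in> F" "f \<otimes> a \<preceq> \<zero>" using assms by (auto simp: cong_iff)
  then show "a \<rightharpoonup> \<zero> \<in> F"
    using assms residuation[of f a \<zero>] filter_carrier filter_up[of F f] by blast
next
  assume "a \<rightharpoonup> \<zero> \<in> F"
  then show "rl_cong A F a \<zero>" using assms by (auto simp: cong_iff intro!: bexI[of _ "a \<rightharpoonup> \<zero>"])
qed

lemma class_eq_iff:
  assumes "rl_filter A F" "a \<in> carrier A" "b \<in> carrier A"
  shows "rl_class A F a = rl_class A F b \<longleftrightarrow> rl_cong A F a b"
proof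
  assume "rl_class A F a = rl_class A F b"
  moreover have "b \<in> rl_class A F b" using assms cong_refl by (simp add: rl_class_def)
  ultimately have "b \<in> rl_class A F a" by simp
  then show "rl_cong A F a b" by (simp add: rl_class_def)
next
  assume ab: "rl_cong A F a b"
  then have "rl_cong A F a c \<longleftrightarrow> rl_cong A F b c" if "c \<in> carrier A" for c
    using assms that cong_sym[of F a b] cong_trans[of F a b c] cong_trans[of F b a c] by blast
  then show "rl_class A F a = rl_class A F b" by (auto simp: rl_class_def)
qed

text \<open>Multiplying by \<open>k\<close> annihilates the summand with \<open>l\<close>, so
  \<open>k\<close> itself witnesses the congruence. If \<open>l\<close> belongs to a second filter,
  the same element is congruent to \<open>b\<close> there by symmetry: the Chinese remainder step
  for two filters.\<close>

lemma cong_convex_combination: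
  assumes F: "rl_filter A F" and "k \<in> F" "k \<otimes> l = \<zero>"
    and c: "a \<in> carrier A" "b \<in> carrier A" "l \<in> carrier A"
  shows "rl_cong A F ((a \<otimes> k) \<curlyvee> (b \<otimes> l)) a"
proof -
  have k: "k \<in> carrier A" using assms filter_carrier by blast
  have "k \<otimes> (b \<otimes> l) = b \<otimes> (k \<otimes> l)" using c k by (simp add: m_ac)
  then have "k \<otimes> ((a \<otimes> k) \<curlyvee> (b \<otimes> l)) = k \<otimes> (a \<otimes> k)"
    using assms k by (simp add: mult_join_distrib2)
  moreover have "k \<otimes> (a \<otimes> k) \<preceq> a"
    using c k le_trans[of "k \<otimes> (a \<otimes> k)" "a \<otimes> k" a] by simp
  ultimately show ?thesis
    using assms k by (auto simp: cong_iff m_comm[of k a] intro!: bexI[of _ k])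
qed

subsection \<open>Maximality forces finitely many maximal filters\<close>

text \<open>Multiply elements of \<open>M\<close> that separate it from the individual members of
  \<open>K\<close>: the product stays in \<open>M\<close>, and its negation lies above the negation
  of every factor.\<close>

lemma maximal_filter_separation:
  assumes "finite K" "rl_maximal_filter A M" "\<And>N. N \<in> K \<Longrightarrow> rl_maximal_filter A N" "M \<notin> K"
  shows "\<exists>m\<in>M. \<forall>N\<in>K. m \<rightharpoonup> \<zero> \<in> N"
  using assms(1,3,4)
proof (induction K rule: finite_induct)
  case empty
  then show ?case using filter_one maximal_filterD(1)[OF assms(2)] by blast
next
  case (insert P K)
  note F = maximal_filterD(1)[OF assms(2)]
  obtain m where m: "m \<in> M" "\<forall>N\<in>K. m \<rightharpoonup> \<zero> \<in> N" using insert by auto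
  obtain p where p: "p \<in> M" "p \<rightharpoonup> \<zero> \<in> P"
    using maximal_filters_comaximal[OF assms(2), of P] insert by auto
  have c: "m \<in> carrier A" "p \<in> carrier A" using m p filter_carrier[OF F] by auto
  have "(m \<rightharpoonup> \<zero>) \<otimes> (m \<otimes> p) = \<zero>" "(p \<rightharpoonup> \<zero>) \<otimes> (m \<otimes> p) = \<zero>"
    using c m_lcomm[of "p \<rightharpoonup> \<zero>" m p] by (simp_all add: m_assoc[symmetric])
  then have "m \<rightharpoonup> \<zero> \<preceq> (m \<otimes> p) \<rightharpoonup> \<zero>" "p \<rightharpoonup> \<zero> \<preceq> (m \<otimes> p) \<rightharpoonup> \<zero>"
    using c by (simp_all add: residuation)
  then have "(m \<otimes> p) \<rightharpoonup> \<zero> \<in> N" if "N \<in> insert P K" for N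
    using that m(2) p(2) insert.prems(1) maximal_filterD(1) filter_up c
    by (metis imp_closed insertE m_closed zero_closed)
  then show ?case using filter_mult[OF F m(1) p(1)] by blast
qed

lemma maximal_filters_chinese_remainder:
  assumes "finite K" "\<And>N. N \<in> K \<Longrightarrow> rl_maximal_filter A N" "\<And>N. N \<in> K \<Longrightarrow> a N \<in> carrier A"
  shows "\<exists>x\<in>carrier A. \<forall>N\<in>K. rl_cong A N x (a N)"
  using assms
proof (induction K rule: finite_induct)
  case empty
  then show ?case by blast
next
  case (insert M K)
  obtain x where x: "x \<in> carrier A" "\<forall>N\<in>K. rl_cong A N x (a N)" using insert by auto
  obtain m where m: "m \<in> M" "\<forall>N\<in>K. m \<rightharpoonup> \<zero> \<in> N"
    using maximal_filter_separation[of K M] insert by auto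
  have FM: "rl_filter A M" and aM: "a M \<in> carrier A" using insert maximal_filterD by auto
  have mc: "m \<in> carrier A" using m FM filter_carrier by blast
  \<comment> \<open>Since \<open>m\<close> is in \<open>M\<close> and its negation is in every
    member of \<open>K\<close>, this follows the new target modulo \<open>M\<close> and the old
    solution \<open>x\<close> modulo each member of \<open>K\<close>.\<close>
  let ?y = "(a M \<otimes> m) \<curlyvee> (x \<otimes> (m \<rightharpoonup> \<zero>))"
  have y: "?y \<in> carrier A" using mc aM x by simp
  have "rl_cong A M ?y (a M)"
    using cong_convex_combination[OF FM m(1)] mc aM x by simp
  moreover have "rl_cong A N ?y (a N)" if N: "N \<in> K" for N
  proof -
    have F: "rl_filter A N" using insert N maximal_filterD by auto
    have "rl_cong A N ((x \<otimes> (m \<rightharpoonup> \<zero>)) \<curlyvee> (a M \<otimes> m)) x"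
      using cong_convex_combination[OF F, of "m \<rightharpoonup> \<zero>" m x "a M"] m N mc aM x by simp
    then have "rl_cong A N ?y x" using mc aM x by (simp add: join_comm)
    then show ?thesis using cong_trans[OF F, of ?y x "a N"] x N y insert.prems by auto
  qed
  ultimately show ?case using y by blast
qed

text \<open>The targets form the characteristic function of the point \<open>M\<close> on the set of
  all maximal filters. Congruence to \<open>\<one>\<close> means membership, and congruence to
  \<open>\<zero>\<close> means membership of the negation.\<close>

lemma maximal_filter_isolating:
  assumes "rl_maximal A" and M: "rl_maximal_filter A M"
  shows "\<exists>u\<in>M. \<forall>N. rl_maximal_filter A N \<and> N \<noteq> M \<longrightarrow> u \<rightharpoonup> \<zero> \<in> N"
proof -
  have "\<exists>x\<in>carrier A. \<forall>N\<in>{N. rl_maximal_filter A N}. rl_cong A N x (if N = M then \<one> else \<zero>)"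
  proof (rule rl_maximal_family[OF assms(1)])
    fix J assume "finite J" "J \<subseteq> {N. rl_maximal_filter A N}"
    then show "\<exists>x\<in>carrier A. \<forall>N\<in>J. rl_cong A N x (if N = M then \<one> else \<zero>)"
      by (intro maximal_filters_chinese_remainder) auto
  qed (auto dest: maximal_filterD)
  then obtain x where x: "x \<in> carrier A"
    "\<And>N. rl_maximal_filter A N \<Longrightarrow> rl_cong A N x (if N = M then \<one> else \<zero>)" by blast
  have "x \<in> M" using x(2)[OF M] x(1) M cong_one_iff maximal_filterD by auto
  moreover have "x \<rightharpoonup> \<zero> \<in> N" if "rl_maximal_filter A N" "N \<noteq> M" for N
    using x(2)[of N] that x(1) cong_zero_iff maximal_filterD by auto
  ultimately show ?thesis by blast
qed

text \<open>If there were infinitely many maximal filters, the elements lying in all but finitely many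
  of them would form a proper filter. A maximal filter \<open>M\<close> above it would contain
  both an element isolating \<open>M\<close> and its negation.\<close>

lemma finite_maximal_filters:
  assumes "rl_maximal A"
  shows "finite {M. rl_maximal_filter A M}"
proof (rule ccontr)
  assume inf: "infinite {M. rl_maximal_filter A M}"
  let ?bad = "\<lambda>a. {N. rl_maximal_filter A N \<and> a \<notin> N}"
  let ?C = "{a \<in> carrier A. finite (?bad a)}"
  have "rl_filter A ?C"
  proof (rule filterI)
    have "?bad \<one> = {}" using filter_one maximal_filterD by auto
    then show "\<one> \<in> ?C" by (simp only: mem_Collect_eq) simp
  next
    fix a b assume ab: "a \<in> ?C" "b \<in> ?C"
    have "?bad (a \<otimes> b) \<subseteq> ?bad a \<union> ?bad b" using filter_mult maximal_filterD by blast
    then show "a \<otimes> b \<in> ?C" using ab finite_subset[of "?bad (a \<otimes> b)"] by auto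
  next
    fix a b assume ab: "a \<in> ?C" "b \<in> carrier A" "a \<preceq> b"
    have "?bad b \<subseteq> ?bad a" using ab filter_up maximal_filterD by blast
    then show "b \<in> ?C" using ab finite_subset[of "?bad b"] by auto
  qed auto
  \<comment> \<open>No maximal filter contains \<open>\<zero>\<close>, so the assumed infinitude is
    exactly what makes \<open>?C\<close> proper.\<close>
  moreover have "?bad \<zero> = {M. rl_maximal_filter A M}" using maximal_filterD by auto
  then have "\<zero> \<notin> ?C" using inf by auto
  ultimately obtain M where M: "rl_maximal_filter A M" "?C \<subseteq> M"
    using maximal_filter_exists proper_filter_iff by blast
  obtain u where u: "u \<in> M" "\<And>N. rl_maximal_filter A N \<Longrightarrow> N \<noteq> M \<Longrightarrow> u \<rightharpoonup> \<zero> \<in> N"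
    using maximal_filter_isolating[OF assms M(1)] by blast
  have "?bad (u \<rightharpoonup> \<zero>) \<subseteq> {M}" using u by auto
  then have "finite (?bad (u \<rightharpoonup> \<zero>))" using finite_subset by blast
  moreover have "u \<in> carrier A" using u(1) M(1) filter_carrier maximal_filterD(1) by blast
  ultimately have "u \<rightharpoonup> \<zero> \<in> ?C" by simp
  then show False using M u(1) maximal_filter_neg by blast
qed

subsection \<open>The Boolean center\<close>

text \<open>For \<open>?m = a \<curlywedge> e\<close>, expand
  \<open>?m = ?m \<otimes> (e \<curlyvee> g)\<close>; the part \<open>?m \<otimes> g\<close> is
  below \<open>e \<otimes> g = \<zero>\<close>, leaving \<open>?m = ?m \<otimes> e\<close>.\<close>

lemma complement_mult_eq_meet:
  assumes "e \<in> carrier A" "g \<in> carrier A" "e \<otimes> g = \<zero>" "e \<curlyvee> g = \<one>" "a \<in> carrier A"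
  shows "a \<otimes> e = a \<curlywedge> e"
proof (rule le_antisym)
  let ?m = "a \<curlywedge> e"
  have m: "?m \<in> carrier A" using assms by simp
  have "?m \<otimes> g \<preceq> e \<otimes> g" using assms by (intro mult_mono) simp_all
  then have "?m \<otimes> g = \<zero>" using assms m by (simp add: le_zero_iff)
  moreover have "?m \<otimes> (e \<curlyvee> g) = (?m \<otimes> e) \<curlyvee> (?m \<otimes> g)"
    using m assms by (intro mult_join_distrib2)
  ultimately have "?m = ?m \<otimes> e" using m assms by simp
  moreover have "?m \<otimes> e \<preceq> a \<otimes> e" using assms by (intro mult_mono) simp_all
  ultimately show "a \<curlywedge> e \<preceq> a \<otimes> e" by simp
qed (use assms in simp_all)

text \<open>Phrasing complements by \<open>\<otimes>\<close> makes distributivity over joins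
  available, which \<open>\<curlywedge>\<close> does not offer.\<close>

lemma Boolean_center_iff:
  "e \<in> rl_Boolean_center A \<longleftrightarrow>
    e \<in> carrier A \<and> (\<exists>g\<in>carrier A. e \<otimes> g = \<zero> \<and> e \<curlyvee> g = \<one>)"
proof -
  have "e \<curlywedge> g = \<zero> \<longleftrightarrow> e \<otimes> g = \<zero>"
    if "e \<in> carrier A" "g \<in> carrier A" "e \<curlyvee> g = \<one>" for g
  proof
    assume "e \<curlywedge> g = \<zero>"
    moreover have "e \<otimes> g \<preceq> e \<curlywedge> g" using that by simp
    ultimately show "e \<otimes> g = \<zero>" using that by (simp add: le_zero_iff)
  next
    assume "e \<otimes> g = \<zero>"
    then show "e \<curlywedge> g = \<zero>"
      using that complement_mult_eq_meet[of e g g] by (simp add: meet_comm m_comm)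
  qed
  then show ?thesis unfolding rl_Boolean_center_def by blast
qed

lemma Boolean_center_carrier: "e \<in> rl_Boolean_center A \<Longrightarrow> e \<in> carrier A"
  by (simp add: rl_Boolean_center_def)

lemma Boolean_center_mult:
  "\<lbrakk>e \<in> rl_Boolean_center A; a \<in> carrier A\<rbrakk> \<Longrightarrow> a \<otimes> e = a \<curlywedge> e"
  unfolding Boolean_center_iff using complement_mult_eq_meet by blast

lemma Boolean_center_idem: "e \<in> rl_Boolean_center A \<Longrightarrow> e \<otimes> e = e"
  using Boolean_center_mult Boolean_center_carrier meet_idem by simp

lemma Boolean_center_absorb:
  "\<lbrakk>e \<in> rl_Boolean_center A; a \<in> carrier A; a \<preceq> e\<rbrakk> \<Longrightarrow> a \<otimes> e = a"
  by (simp add: Boolean_center_mult rl_le_def)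

lemma Boolean_center_zero: "\<zero> \<in> rl_Boolean_center A"
  by (auto simp: Boolean_center_iff)

text \<open>As in De Morgan's law, the complement is the product \<open>g \<otimes> h\<close> of the
  complements. Covering follows by expanding
  \<open>\<one> = (e \<curlyvee> g) \<otimes> (f \<curlyvee> h)\<close> into four products, each
  below \<open>?s\<close>.\<close>

lemma Boolean_center_join:
  assumes "e \<in> rl_Boolean_center A" "f \<in> rl_Boolean_center A"
  shows "e \<curlyvee> f \<in> rl_Boolean_center A"
proof -
  obtain g h where gh: "g \<in> carrier A" "e \<otimes> g = \<zero>" "e \<curlyvee> g = \<one>"
      "h \<in> carrier A" "f \<otimes> h = \<zero>" "f \<curlyvee> h = \<one>"
    using assms by (auto simp: Boolean_center_iff)
  have c: "e \<in> carrier A" "f \<in> carrier A" using assms Boolean_center_carrier by auto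
  have "e \<otimes> (g \<otimes> h) = \<zero>" "f \<otimes> (g \<otimes> h) = \<zero>"
    using c gh m_assoc[of e g h, symmetric] m_lcomm[of f g h] by simp_all
  then have 1: "(e \<curlyvee> f) \<otimes> (g \<otimes> h) = \<zero>" using c gh by (simp add: mult_join_distrib)
  let ?s = "(e \<curlyvee> f) \<curlyvee> (g \<otimes> h)"
  have s: "?s \<in> carrier A" using c gh by simp
  have below: "x \<preceq> ?s" if "x \<preceq> y" "y \<preceq> e \<curlyvee> f" "x \<in> carrier A" "y \<in> carrier A" for x y
    using that c gh s le_trans[of x y "e \<curlyvee> f"] le_trans[of x "e \<curlyvee> f" ?s] by simp
  have "(e \<curlyvee> g) \<otimes> (f \<curlyvee> h) =
      ((e \<otimes> f) \<curlyvee> (g \<otimes> f)) \<curlyvee> ((e \<otimes> h) \<curlyvee> (g \<otimes> h))"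
    using c gh(1,4) by (simp only: mult_join_distrib mult_join_distrib2 join_closed m_closed)
  moreover have "e \<otimes> f \<preceq> ?s" "g \<otimes> f \<preceq> ?s" "e \<otimes> h \<preceq> ?s"
    using c gh(1,4) below[of "e \<otimes> f" e] below[of "g \<otimes> f" f] below[of "e \<otimes> h" e] by simp_all
  moreover have "g \<otimes> h \<preceq> ?s" using c gh(1,4) by simp
  ultimately have "(e \<curlyvee> g) \<otimes> (f \<curlyvee> h) \<preceq> ?s" using c gh(1,4) s by simp
  then have "\<one> \<preceq> ?s" using gh by simp
  then have "?s = \<one>" using s one_le_iff by blast
  with 1 show ?thesis using c gh by (auto simp: Boolean_center_iff intro!: bexI[of _ "g \<otimes> h"])
qed

text \<open>Idempotency makes the principal up-set of \<open>c\<close> closed under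
  \<open>\<otimes>\<close>. Were \<open>c\<close> nonzero, this filter would be proper and would
  extend to a maximal filter containing \<open>c\<close>.\<close>

lemma idempotent_eq_zero:
  assumes c: "c \<in> carrier A" and idem: "c \<otimes> c = c"
    and avoid: "\<And>M. rl_maximal_filter A M \<Longrightarrow> c \<notin> M"
  shows "c = \<zero>"
proof (rule ccontr)
  assume "c \<noteq> \<zero>"
  let ?F = "{x \<in> carrier A. c \<preceq> x}"
  have "rl_filter A ?F"
  proof (rule filterI)
    fix a b assume "a \<in> ?F" "b \<in> ?F"
    then show "a \<otimes> b \<in> ?F" using c idem mult_mono[of c a c b] by simp
  next
    fix a b assume "a \<in> ?F" "b \<in> carrier A" "a \<preceq> b"
    then show "b \<in> ?F" using c le_trans[of c a b] by simp
  qed (use c in auto)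
  moreover have "\<zero> \<notin> ?F" using c \<open>c \<noteq> \<zero>\<close> le_zero_iff by simp
  ultimately obtain M where "rl_maximal_filter A M" "?F \<subseteq> M"
    using maximal_filter_exists proper_filter_iff by blast
  then show False using avoid c by auto
qed

text \<open>The complement \<open>g\<close> is idempotent and lies in no maximal filter, because
  \<open>e\<close> lies in all of them and \<open>e \<otimes> g = \<zero>\<close>.\<close>

lemma Boolean_center_eq_one:
  assumes e: "e \<in> rl_Boolean_center A" and mem: "\<And>M. rl_maximal_filter A M \<Longrightarrow> e \<in> M"
  shows "e = \<one>"
proof -
  obtain g where g: "g \<in> carrier A" "e \<otimes> g = \<zero>" "e \<curlyvee> g = \<one>" and c: "e \<in> carrier A"
    using e by (auto simp: Boolean_center_iff)
  have "g = \<zero>"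
  proof (rule idempotent_eq_zero[OF g(1)])
    show "g \<otimes> g = g"
      using complement_mult_eq_meet[of g e g] g c by (simp add: m_comm join_comm meet_idem)
    fix M assume M: "rl_maximal_filter A M"
    show "g \<notin> M"
    proof
      assume "g \<in> M"
      then have "e \<otimes> g \<in> M" using M mem filter_mult maximal_filterD by blast
      then show False using M g maximal_filterD by simp
    qed
  qed
  then show ?thesis using g c by simp
qed

subsection \<open>Lifting along the radical\<close>

lemma Rad_filter: "rl_filter A (rl_Rad A)"
  unfolding rl_Rad_def
  by (rule filterI) (auto intro: filter_one filter_mult filter_up dest: maximal_filterD(1))

lemma quotient_meet_class:
  assumes F: "rl_filter A F" and c: "a \<in> carrier A" "b \<in> carrier A"
  shows "rl_class A F a \<curlywedge>\<^bsub>rl_quotient A F\<^esub> rl_class A F b = rl_class A F (a \<curlywedge> b)"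
proof -
  have "rl_class A F (x \<curlywedge> y) = rl_class A F (a \<curlywedge> b)"
    if "x \<in> rl_class A F a" "y \<in> rl_class A F b" for x y
  proof -
    have xy: "x \<in> carrier A" "y \<in> carrier A" "rl_cong A F a x" "rl_cong A F b y"
      using that by (auto simp: rl_class_def)
    then have "rl_cong A F (a \<curlywedge> b) (x \<curlywedge> y)" using F c by (intro cong_meet)
    then show ?thesis
      using class_eq_iff[OF F, of "a \<curlywedge> b" "x \<curlywedge> y"] xy(1,2) c by simp
  qed
  moreover have "a \<in> rl_class A F a" "b \<in> rl_class A F b"
    using c F cong_refl by (auto simp: rl_class_def)
  ultimately have "(\<Union>x\<in>rl_class A F a. \<Union>y\<in>rl_class A F b. rl_class A F (x \<curlywedge> y)) =
      rl_class A F (a \<curlywedge> b)" by blast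
  then show ?thesis by (simp add: rl_quotient_def)
qed

lemma quotient_join_class:
  assumes F: "rl_filter A F" and c: "a \<in> carrier A" "b \<in> carrier A"
  shows "rl_class A F a \<curlyvee>\<^bsub>rl_quotient A F\<^esub> rl_class A F b = rl_class A F (a \<curlyvee> b)"
proof -
  have "rl_class A F (x \<curlyvee> y) = rl_class A F (a \<curlyvee> b)"
    if "x \<in> rl_class A F a" "y \<in> rl_class A F b" for x y
  proof -
    have xy: "x \<in> carrier A" "y \<in> carrier A" "rl_cong A F a x" "rl_cong A F b y"
      using that by (auto simp: rl_class_def)
    then have "rl_cong A F (a \<curlyvee> b) (x \<curlyvee> y)" using F c by (intro cong_join)
    then show ?thesis
      using class_eq_iff[OF F, of "a \<curlyvee> b" "x \<curlyvee> y"] xy(1,2) c by simp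
  qed
  moreover have "a \<in> rl_class A F a" "b \<in> rl_class A F b"
    using c F cong_refl by (auto simp: rl_class_def)
  ultimately have "(\<Union>x\<in>rl_class A F a. \<Union>y\<in>rl_class A F b. rl_class A F (x \<curlyvee> y)) =
      rl_class A F (a \<curlyvee> b)" by blast
  then show ?thesis by (simp add: rl_quotient_def)
qed

text \<open>The complement is the class of the negation \<open>?v\<close>. Both
  \<open>u \<curlyvee> ?v\<close> and the negation of \<open>u \<curlywedge> ?v\<close> lie above
  \<open>u\<close> and above \<open>?v\<close>, hence in every maximal filter and so in the
  radical.\<close>

lemma class_in_Boolean_center:
  assumes u: "u \<in> carrier A"
    and dec: "\<And>N. rl_maximal_filter A N \<Longrightarrow> u \<in> N \<or> u \<rightharpoonup> \<zero> \<in> N"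
  shows "rl_class A (rl_Rad A) u \<in> rl_Boolean_center (rl_quotient A (rl_Rad A))"
proof -
  let ?R = "rl_Rad A" and ?v = "u \<rightharpoonup> \<zero>"
  let ?m = "u \<curlywedge> ?v"
  have v: "?v \<in> carrier A" and m: "?m \<in> carrier A" using u by simp_all
  \<comment> \<open>Each product bounds \<open>?m\<close> by the other one of \<open>u\<close> and
    \<open>?v\<close>, so that both right-hand sides are \<open>\<zero>\<close>.\<close>
  have "?m \<otimes> u \<preceq> ?v \<otimes> u" "?m \<otimes> ?v \<preceq> u \<otimes> ?v"
    using u v by (intro mult_mono_left; simp)+
  then have "u \<otimes> ?m \<preceq> \<zero>" "?v \<otimes> ?m \<preceq> \<zero>"
    using u v m m_comm[of u ?m] m_comm[of ?v ?m] by simp_all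
  then have le: "u \<preceq> ?m \<rightharpoonup> \<zero>" "?v \<preceq> ?m \<rightharpoonup> \<zero>" using u v m by (simp_all add: residuation)
  have "?m \<rightharpoonup> \<zero> \<in> N" "u \<curlyvee> ?v \<in> N" if N: "rl_maximal_filter A N" for N
  proof -
    have F: "rl_filter A N" using N maximal_filterD by blast
    show "?m \<rightharpoonup> \<zero> \<in> N"
      using dec[OF N] filter_up[OF F _ le(1)] filter_up[OF F _ le(2)] m by blast
    show "u \<curlyvee> ?v \<in> N"
      using dec[OF N] filter_up[OF F, of u "u \<curlyvee> ?v"] filter_up[OF F, of ?v "u \<curlyvee> ?v"]
        join_upper1[OF u v] join_upper2[OF u v] u v by blast
  qed
  then have "?m \<rightharpoonup> \<zero> \<in> ?R" "u \<curlyvee> ?v \<in> ?R" using m u v by (auto simp: rl_Rad_def)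
  then have "rl_class A ?R ?m = rl_class A ?R \<zero>" "rl_class A ?R (u \<curlyvee> ?v) = rl_class A ?R \<one>"
    using m u v Rad_filter by (simp_all add: class_eq_iff cong_zero_iff cong_one_iff)
  then have "rl_class A ?R u \<curlywedge>\<^bsub>rl_quotient A ?R\<^esub> rl_class A ?R ?v = \<zero>\<^bsub>rl_quotient A ?R\<^esub>"
    "rl_class A ?R u \<curlyvee>\<^bsub>rl_quotient A ?R\<^esub> rl_class A ?R ?v = \<one>\<^bsub>rl_quotient A ?R\<^esub>"
    using u v Rad_filter
    by (simp_all add: quotient_meet_class quotient_join_class) (simp_all add: rl_quotient_def)
  moreover have "rl_class A ?R u \<in> carrier (rl_quotient A ?R)"
    "rl_class A ?R ?v \<in> carrier (rl_quotient A ?R)"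
    using u v by (simp_all add: rl_quotient_def)
  ultimately show ?thesis unfolding rl_Boolean_center_def by blast
qed

text \<open>Congruence modulo the radical implies congruence modulo every maximal filter, so a lift
  \<open>f\<close> of the class of \<open>u\<close> inherits the isolating pattern of
  \<open>u\<close>.\<close>

lemma Boolean_isolating:
  assumes "rl_maximal A" "rl_lifting_Boolean_center A" and M: "rl_maximal_filter A M"
  shows "\<exists>f\<in>rl_Boolean_center A. f \<in> M \<and>
    (\<forall>N. rl_maximal_filter A N \<and> N \<noteq> M \<longrightarrow> f \<rightharpoonup> \<zero> \<in> N)"
proof -
  let ?R = "rl_Rad A"
  obtain u where u: "u \<in> M" "\<And>N. rl_maximal_filter A N \<Longrightarrow> N \<noteq> M \<Longrightarrow> u \<rightharpoonup> \<zero> \<in> N"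
    using maximal_filter_isolating[OF assms(1) M] by blast
  have uc: "u \<in> carrier A" using u(1) M filter_carrier maximal_filterD(1) by blast
  have "rl_class A ?R u \<in> rl_Boolean_center (rl_quotient A ?R)"
    using class_in_Boolean_center[OF uc] u by blast
  then obtain f where f: "f \<in> rl_Boolean_center A" "rl_class A ?R u = rl_class A ?R f"
    using assms(2) unfolding rl_lifting_Boolean_center_def by blast
  have fc: "f \<in> carrier A" using f Boolean_center_carrier by blast
  have cong: "rl_cong A N f u" if "rl_maximal_filter A N" for N
  proof -
    have "rl_cong A ?R f u" using f(2) fc uc Rad_filter class_eq_iff by metis
    then show ?thesis using that unfolding rl_cong_def rl_Rad_def by blast
  qed
  have "f \<in> M"
  proof -
    have F: "rl_filter A M" using M maximal_filterD by blast
    then have "rl_cong A M f \<one>"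
      using cong[OF M] cong_trans[OF F, of f u \<one>] u(1) uc fc by (simp add: cong_one_iff)
    then show ?thesis using F fc cong_one_iff by simp
  qed
  moreover have "f \<rightharpoonup> \<zero> \<in> N" if N: "rl_maximal_filter A N" "N \<noteq> M" for N
  proof -
    have F: "rl_filter A N" using N maximal_filterD by blast
    then have "rl_cong A N f \<zero>"
      using cong[OF N(1)] cong_trans[OF F, of f u \<zero>] u(2)[OF N] uc fc by (simp add: cong_zero_iff)
    then show ?thesis using F fc cong_zero_iff by simp
  qed
  ultimately show ?thesis using f(1) by blast
qed

end

subsection \<open>Intervals below central elements\<close>

text \<open>For \<open>e\<close> in the Boolean center this is a copy of the quotient by the
  principal filter of \<open>e\<close>, with \<open>a \<otimes> e\<close> as the representative of
  the class of \<open>a\<close>. The implication is cut down by \<open>e\<close> because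
  \<open>a \<rightharpoonup> b\<close> may leave the interval.\<close>

definition rl_interval :: "'a reslat \<Rightarrow> 'a \<Rightarrow> 'a reslat"
  where "rl_interval A e =
    \<lparr>carrier = {a \<in> carrier A. a \<preceq>\<^bsub>A\<^esub> e},
     mult = mult A,
     one = e,
     rl_join = rl_join A,
     rl_meet = rl_meet A,
     rl_imp = (\<lambda>a b. (a \<rightharpoonup>\<^bsub>A\<^esub> b) \<curlywedge>\<^bsub>A\<^esub> e),
     rl_zero = \<zero>\<^bsub>A\<^esub>\<rparr>"

lemma rl_interval_simps [simp]:
  "carrier (rl_interval A e) = {a \<in> carrier A. a \<preceq>\<^bsub>A\<^esub> e}"
  "mult (rl_interval A e) = mult A"
  "one (rl_interval A e) = e"
  "rl_join (rl_interval A e) = rl_join A"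
  "rl_meet (rl_interval A e) = rl_meet A"
  "rl_imp (rl_interval A e) = (\<lambda>a b. (a \<rightharpoonup>\<^bsub>A\<^esub> b) \<curlywedge>\<^bsub>A\<^esub> e)"
  "rl_zero (rl_interval A e) = \<zero>\<^bsub>A\<^esub>"
  "rl_le (rl_interval A e) = rl_le A"
  by (simp_all add: rl_interval_def rl_le_def fun_eq_iff)

primrec rl_big_join :: "'a reslat \<Rightarrow> (nat \<Rightarrow> 'a) \<Rightarrow> nat \<Rightarrow> 'a"
  where "rl_big_join A x 0 = \<zero>\<^bsub>A\<^esub>"
  | "rl_big_join A x (Suc n) = rl_big_join A x n \<curlyvee>\<^bsub>A\<^esub> x n"

context residuated_lattice
begin

lemma meet_le: "\<lbrakk>a \<preceq> e; a \<in> carrier A; b \<in> carrier A; e \<in> carrier A\<rbrakk> \<Longrightarrow> a \<curlywedge> b \<preceq> e"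
  using le_trans[of "a \<curlywedge> b" a e] by simp

lemma mult_le: "\<lbrakk>a \<preceq> e; a \<in> carrier A; b \<in> carrier A; e \<in> carrier A\<rbrakk> \<Longrightarrow> a \<otimes> b \<preceq> e"
  using le_trans[of "a \<otimes> b" a e] by simp

text \<open>Below a Boolean \<open>e\<close>, multiplication by \<open>e\<close> is the identity, so
  \<open>e\<close> is a unit; and for \<open>a \<preceq> e\<close> the truncation of the implication
  does not affect residuation.\<close>

lemma interval_residuated_lattice:
  assumes e: "e \<in> rl_Boolean_center A"
  shows "residuated_lattice (rl_interval A e)"
proof -
  have c: "e \<in> carrier A" using e Boolean_center_carrier by blast
  show ?thesis
  proof (unfold_locales, goal_cases)
    \<comment> \<open>Goals 4 and 5 are the unit laws and goal 19 is residuation; the others are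
      inherited from \<open>A\<close>, with closure using that the interval is a down-set.\<close>
    case (4 x)
    then show ?case using e c Boolean_center_absorb[of e x] by (simp add: m_comm)
  next
    case (5 x)
    then show ?case using e Boolean_center_absorb by simp
  next
    case (19 a b d)
    have "a \<preceq> (b \<rightharpoonup> d) \<curlywedge> e \<longleftrightarrow> a \<preceq> b \<rightharpoonup> d"
      using 19 c by simp
    then show ?case using 19 by (simp add: residuation)
  qed (use c in \<open>simp_all add: meet_le mult_le m_ac meet_assoc join_assoc
      join_meet_absorb meet_join_absorb, (metis meet_comm join_comm)+\<close>)
qed

text \<open>This is the preimage of \<open>F\<close> under the map sending \<open>a\<close> to
  \<open>a \<otimes> e\<close>, which is multiplicative because \<open>e\<close> is
  idempotent.\<close>

lemma interval_filter_pullback: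
  assumes e: "e \<in> rl_Boolean_center A" and F: "rl_filter (rl_interval A e) F"
  shows "rl_filter A {a \<in> carrier A. a \<otimes> e \<in> F}"
proof -
  interpret E: residuated_lattice "rl_interval A e" by (rule interval_residuated_lattice[OF e])
  have c: "e \<in> carrier A" using e Boolean_center_carrier by blast
  show ?thesis
  proof (rule filterI)
    show "\<one> \<in> {a \<in> carrier A. a \<otimes> e \<in> F}" using c E.filter_one[OF F] by simp
  next
    fix a b assume ab: "a \<in> {a \<in> carrier A. a \<otimes> e \<in> F}" "b \<in> {a \<in> carrier A. a \<otimes> e \<in> F}"
    then have "(a \<otimes> e) \<otimes> (b \<otimes> e) \<in> F" using E.filter_mult[OF F] by simp
    moreover have "(a \<otimes> e) \<otimes> (b \<otimes> e) = (a \<otimes> b) \<otimes> (e \<otimes> e)" using ab c by (simp add: m_ac)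
    ultimately show "a \<otimes> b \<in> {a \<in> carrier A. a \<otimes> e \<in> F}"
      using ab e by (simp add: Boolean_center_idem)
  next
    fix a b assume "a \<in> {a \<in> carrier A. a \<otimes> e \<in> F}" "b \<in> carrier A" "a \<preceq> b"
    then show "b \<in> {a \<in> carrier A. a \<otimes> e \<in> F}"
      using c E.filter_up[OF F, of "a \<otimes> e" "b \<otimes> e"] mult_mono_left by simp
  qed auto
qed

text \<open>Truncating both implications by \<open>e\<close> multiplies their meet by
  \<open>e\<close>. The elements \<open>a\<close> and \<open>b\<close> range over all of
  \<open>A\<close>, so congruences can be transferred for elements outside the interval too.\<close>

lemma interval_cong_iff:
  assumes e: "e \<in> rl_Boolean_center A" and c: "a \<in> carrier A" "b \<in> carrier A"
  shows "rl_cong (rl_interval A e) F a b \<longleftrightarrow> rl_cong A {a \<in> carrier A. a \<otimes> e \<in> F} a b"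
proof -
  have ec: "e \<in> carrier A" using e Boolean_center_carrier by blast
  let ?p = "a \<rightharpoonup> b" and ?q = "b \<rightharpoonup> a"
  have p: "?p \<in> carrier A" "?q \<in> carrier A" using c by auto
  have "(?p \<curlywedge> e) \<curlywedge> (?q \<curlywedge> e) = (?p \<curlywedge> ?q) \<curlywedge> e"
    using p ec meet_assoc meet_comm meet_idem by (smt (verit) meet_closed)
  also have "\<dots> = (?p \<curlywedge> ?q) \<otimes> e" using p e by (simp add: Boolean_center_mult)
  finally show ?thesis using p by (simp add: rl_cong_def)
qed

text \<open>Solve the pulled-back system in \<open>A\<close> and project the solution
  \<open>x\<close> to \<open>x \<otimes> e\<close>. Every pulled-back filter contains
  \<open>e\<close>, so the projection does not change the class of \<open>x\<close>.\<close>

lemma interval_maximal: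
  assumes e: "e \<in> rl_Boolean_center A" and max: "rl_maximal A"
  shows "rl_maximal (rl_interval A e)"
  unfolding rl_maximal_def
proof (intro allI impI, elim conjE)
  fix I :: "('a \<times> 'a set) set" and a F
  assume mem: "\<forall>i\<in>I. a i \<in> carrier (rl_interval A e) \<and> rl_filter (rl_interval A e) (F i)"
    and fin: "\<forall>J. finite J \<and> J \<subseteq> I \<longrightarrow>
      (\<exists>x\<in>carrier (rl_interval A e). \<forall>i\<in>J. rl_cong (rl_interval A e) (F i) x (a i))"
  have ec: "e \<in> carrier A" using e Boolean_center_carrier by blast
  let ?G = "\<lambda>i. {a \<in> carrier A. a \<otimes> e \<in> F i}"
  have G: "rl_filter A (?G i)" if "i \<in> I" for i
    using interval_filter_pullback[OF e] mem that by blast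
  have "\<exists>x\<in>carrier A. \<forall>i\<in>I. rl_cong A (?G i) x (a i)"
  proof (rule rl_maximal_family[OF max])
    fix i assume "i \<in> I"
    then show "a i \<in> carrier A \<and> rl_filter A (?G i)" using G mem by simp
  next
    fix J assume J: "finite J" "J \<subseteq> I"
    then obtain x where x: "x \<in> carrier A" "\<forall>i\<in>J. rl_cong (rl_interval A e) (F i) x (a i)"
      using fin by force
    have "rl_cong A (?G i) x (a i)" if "i \<in> J" for i
      using x that interval_cong_iff[OF e, of x "a i" "F i"] mem J(2) by auto
    then show "\<exists>x\<in>carrier A. \<forall>i\<in>J. rl_cong A (?G i) x (a i)" using x(1) by blast
  qed
  then obtain x where x: "x \<in> carrier A" "\<And>i. i \<in> I \<Longrightarrow> rl_cong A (?G i) x (a i)" by blast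
  have "rl_cong (rl_interval A e) (F i) (x \<otimes> e) (a i)" if i: "i \<in> I" for i
  proof -
    have a: "a i \<in> carrier A" "a i \<preceq> e" using mem i by auto
    interpret E: residuated_lattice "rl_interval A e" by (rule interval_residuated_lattice[OF e])
    have "e \<in> ?G i" using ec e mem i E.filter_one[of "F i"] by (simp add: Boolean_center_idem)
    moreover have "e \<otimes> (x \<otimes> e) \<preceq> x"
      using mult_le[of "x \<otimes> e" x e] x(1) ec by (simp add: m_comm)
    moreover have "e \<otimes> x \<preceq> x \<otimes> e" using x(1) ec by (simp add: m_comm)
    ultimately have "rl_cong A (?G i) (x \<otimes> e) x"
      using cong_iff[OF G[OF i], of "x \<otimes> e" x] x(1) ec by blast
    then have "rl_cong A (?G i) (x \<otimes> e) (a i)"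
      using cong_trans[OF G[OF i], of "x \<otimes> e" x "a i"] x i a ec by simp
    then show ?thesis using interval_cong_iff[OF e, of "x \<otimes> e" "a i" "F i"] x(1) a ec by simp
  qed
  moreover have "x \<otimes> e \<in> carrier (rl_interval A e)" using x(1) ec by simp
  ultimately show
    "\<exists>x\<in>carrier (rl_interval A e). \<forall>i\<in>I. rl_cong (rl_interval A e) (F i) x (a i)" by blast
qed

text \<open>The trace \<open>?G\<close> of \<open>M\<close> is the greatest proper filter of the
  interval. Indeed, the pullback of a proper filter extends to a maximal filter of \<open>A\<close>;
  this contains \<open>e\<close>, hence is \<open>M\<close>.\<close>

lemma interval_local:
  assumes e: "e \<in> rl_Boolean_center A" and M: "rl_maximal_filter A M" "e \<in> M"
    and unique: "\<And>N. rl_maximal_filter A N \<Longrightarrow> e \<in> N \<Longrightarrow> N = M"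
  shows "rl_local (rl_interval A e)"
proof -
  interpret E: residuated_lattice "rl_interval A e" by (rule interval_residuated_lattice[OF e])
  have ec: "e \<in> carrier A" using e Boolean_center_carrier by blast
  note FM = maximal_filterD[OF M(1)]
  let ?G = "{a \<in> M. a \<preceq> e}"
  have G: "rl_proper_filter (rl_interval A e) ?G"
  proof -
    have "rl_filter (rl_interval A e) ?G"
    proof (rule E.filterI)
      show "?G \<subseteq> carrier (rl_interval A e)" using filter_carrier[OF FM(1)] by auto
      show "\<one>\<^bsub>rl_interval A e\<^esub> \<in> ?G" using M(2) ec by simp
    next
      fix a b assume "a \<in> ?G" "b \<in> ?G"
      then show "a \<otimes>\<^bsub>rl_interval A e\<^esub> b \<in> ?G"
        using filter_carrier[OF FM(1)] filter_mult[OF FM(1)] mult_le ec by simp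
    next
      fix a b assume "a \<in> ?G" "b \<in> carrier (rl_interval A e)" "a \<preceq>\<^bsub>rl_interval A e\<^esub> b"
      then show "b \<in> ?G" using filter_up[OF FM(1), of a b] by simp
    qed
    then show ?thesis using FM(2) by (simp add: E.proper_filter_iff)
  qed
  have greatest: "F \<subseteq> ?G" if F: "rl_proper_filter (rl_interval A e) F" for F
  proof -
    have FF: "rl_filter (rl_interval A e) F" and F0: "\<zero> \<notin> F"
      using F by (simp_all add: E.proper_filter_iff)
    let ?P = "{a \<in> carrier A. a \<otimes> e \<in> F}"
    have "rl_proper_filter A ?P"
      using interval_filter_pullback[OF e FF] F0 ec by (simp add: proper_filter_iff)
    then obtain N where N: "rl_maximal_filter A N" "?P \<subseteq> N" by (rule maximal_filter_exists)
    have "e \<in> ?P" using ec e E.filter_one[OF FF] by (simp add: Boolean_center_idem)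
    then have "N = M" using N unique by blast
    show ?thesis
    proof
      fix a assume a: "a \<in> F"
      then have ac: "a \<in> carrier A" "a \<preceq> e" using E.filter_carrier[OF FF] by auto
      then have "a \<in> ?P" using a Boolean_center_absorb[OF e] by simp
      then show "a \<in> ?G" using N(2) \<open>N = M\<close> ac by blast
    qed
  qed
  have "rl_maximal_filter (rl_interval A e) F \<longleftrightarrow> F = ?G" for F
    unfolding rl_maximal_filter_def using G greatest[of F] greatest by blast
  then show ?thesis by (simp add: rl_local_def)
qed

section \<open>Finite joins and product decompositions from partitions of unity\<close>

lemma big_join_closed [simp]:
  "(\<And>i. i < n \<Longrightarrow> x i \<in> carrier A) \<Longrightarrow> rl_big_join A x n \<in> carrier A"
  by (induction n) auto

lemma big_join_upper:
  assumes "\<And>i. i < n \<Longrightarrow> x i \<in> carrier A" "i < n"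
  shows "x i \<preceq> rl_big_join A x n"
  using assms
proof (induction n)
  case (Suc n)
  have c: "x n \<in> carrier A" "rl_big_join A x n \<in> carrier A" using Suc.prems by auto
  show ?case
  proof (cases "i = n")
    case True
    then show ?thesis using c by simp
  next
    case False
    then have "x i \<preceq> rl_big_join A x n" using Suc by simp
    then show ?thesis
      using c Suc.prems le_trans[of "x i" "rl_big_join A x n" "rl_big_join A x (Suc n)"] by simp
  qed
qed simp

lemma big_join_least:
  assumes "\<And>i. i < n \<Longrightarrow> x i \<in> carrier A" "\<And>i. i < n \<Longrightarrow> x i \<preceq> b" "b \<in> carrier A"
  shows "rl_big_join A x n \<preceq> b"
  using assms by (induction n) auto

lemma big_join_mult:
  assumes "\<And>i. i < n \<Longrightarrow> x i \<in> carrier A" "b \<in> carrier A"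
  shows "rl_big_join A x n \<otimes> b = rl_big_join A (\<lambda>i. x i \<otimes> b) n"
  using assms by (induction n) (auto simp: mult_join_distrib)

lemma big_join_Boolean_center:
  "(\<And>i. i < n \<Longrightarrow> x i \<in> rl_Boolean_center A) \<Longrightarrow> rl_big_join A x n \<in> rl_Boolean_center A"
  by (induction n) (auto intro: Boolean_center_zero Boolean_center_join)

text \<open>Projection to the interval below \<open>f\<close> carries implication to the truncated
  implication there.\<close>

lemma Boolean_center_mult_imp:
  assumes f: "f \<in> rl_Boolean_center A" and c: "a \<in> carrier A" "b \<in> carrier A"
  shows "(a \<rightharpoonup> b) \<otimes> f = ((a \<otimes> f) \<rightharpoonup> (b \<otimes> f)) \<curlywedge> f"
proof (rule le_antisym)
  have fc: "f \<in> carrier A" using f Boolean_center_carrier by blast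
  have "((a \<rightharpoonup> b) \<otimes> f) \<otimes> (a \<otimes> f) = ((a \<rightharpoonup> b) \<otimes> a) \<otimes> (f \<otimes> f)"
    using c fc by (simp add: m_ac)
  moreover have "((a \<rightharpoonup> b) \<otimes> a) \<otimes> f \<preceq> b \<otimes> f"
    using c fc mult_imp_le by (simp add: mult_mono_left)
  ultimately show "(a \<rightharpoonup> b) \<otimes> f \<preceq> ((a \<otimes> f) \<rightharpoonup> (b \<otimes> f)) \<curlywedge> f"
    using c f fc by (simp add: residuation Boolean_center_idem)
  let ?p = "((a \<otimes> f) \<rightharpoonup> (b \<otimes> f)) \<curlywedge> f"
  have p: "?p \<in> carrier A" "?p \<preceq> f" "?p \<preceq> (a \<otimes> f) \<rightharpoonup> (b \<otimes> f)" using c fc by simp_all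
  have pf: "?p \<otimes> f = ?p" using Boolean_center_absorb[OF f p(1,2)] .
  have "?p \<otimes> (a \<otimes> f) \<preceq> b \<otimes> f" using p(1,3) c fc residuation by simp
  then have "?p \<otimes> (a \<otimes> f) \<preceq> b" using p(1) c fc le_trans[of "?p \<otimes> (a \<otimes> f)" "b \<otimes> f" b] by simp
  \<comment> \<open>The factor \<open>f\<close> is moved from \<open>a\<close> to \<open>?p\<close>,
    which absorbs it since \<open>?p \<preceq> f\<close>.\<close>
  moreover have "?p \<otimes> (a \<otimes> f) = (?p \<otimes> f) \<otimes> a" using p(1) c fc by (simp only: m_ac m_closed)
  ultimately have "?p \<preceq> a \<rightharpoonup> b" using p(1) c pf residuation by simp
  then have "?p \<otimes> f \<preceq> (a \<rightharpoonup> b) \<otimes> f" using p(1) c fc by (intro mult_mono_left) auto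
  then show "?p \<preceq> (a \<rightharpoonup> b) \<otimes> f" using pf by simp
qed (use assms Boolean_center_carrier in auto)

lemma partition_of_unity_isomorphic:
  assumes e: "\<And>i. i < n \<Longrightarrow> e i \<in> rl_Boolean_center A"
    and disjoint: "\<And>i j. i < n \<Longrightarrow> j < n \<Longrightarrow> i \<noteq> j \<Longrightarrow> e i \<otimes> e j = \<zero>"
    and cover: "rl_big_join A e n = \<one>"
  shows "rl_isomorphic A (rl_product {..<n} (\<lambda>i. rl_interval A (e i)))"
proof -
  let ?P = "rl_product {..<n} (\<lambda>i. rl_interval A (e i))"
  let ?h = "\<lambda>a. \<lambda>i\<in>{..<n}. a \<otimes> e i"
  have ec: "e i \<in> carrier A" if "i < n" for i using e that Boolean_center_carrier by blast
  \<comment> \<open>Agreement in component \<open>i\<close> puts \<open>e i\<close> below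
    \<open>a \<rightharpoonup> b\<close>; joining over all \<open>i\<close> yields
    \<open>\<one> \<preceq> a \<rightharpoonup> b\<close>. Antisymmetry then gives
    injectivity.\<close>
  have le: "a \<preceq> b" if a: "a \<in> carrier A" "b \<in> carrier A" and h: "?h a = ?h b" for a b
  proof -
    have "e i \<preceq> a \<rightharpoonup> b" if "i < n" for i
    proof -
      have "a \<otimes> e i = b \<otimes> e i" using fun_cong[OF h, of i] that by simp
      then have "e i \<otimes> a = b \<otimes> e i" using a ec that by (simp add: m_comm)
      then show ?thesis using a ec that by (simp add: residuation)
    qed
    then have "\<one> \<preceq> a \<rightharpoonup> b" using big_join_least[of n e "a \<rightharpoonup> b"] ec a cover by simp
    then show ?thesis using a by (simp add: residuation)
  qed
  have "bij_betw ?h (carrier A) (carrier ?P)"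
    unfolding bij_betw_def
  proof
    show "inj_on ?h (carrier A)"
    proof (rule inj_onI)
      fix a b assume "a \<in> carrier A" "b \<in> carrier A" "?h a = ?h b"
      then show "a = b" using le[of a b] le[of b a] le_antisym[of a b] by simp
    qed
    show "?h ` carrier A = carrier ?P"
    proof
      show "?h ` carrier A \<subseteq> carrier ?P"
        using ec by (auto simp: rl_product_def split: if_splits)
      show "carrier ?P \<subseteq> ?h ` carrier A"
      proof
        fix x assume x: "x \<in> carrier ?P"
        then have xc: "x i \<in> carrier A" "x i \<preceq> e i" if "i < n" for i
          using that by (auto simp: rl_product_def dest: PiE_mem)
        \<comment> \<open>The join of all components is the preimage of \<open>x\<close>:
          multiplying by \<open>e j\<close> fixes \<open>x j\<close> and, by disjointness, kills the
          other components.\<close>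
        have "rl_big_join A x n \<otimes> e j = x j" if j: "j < n" for j
        proof -
          have diag: "x j \<otimes> e j = x j" using Boolean_center_absorb[OF e[OF j]] xc[OF j] by simp
          have off: "x i \<otimes> e j = \<zero>" if "i < n" "i \<noteq> j" for i
            using mult_mono_left[of "x i" "e i" "e j"] xc[of i] ec that j disjoint[of i j]
            by (simp add: le_zero_iff)
          have "rl_big_join A (\<lambda>i. x i \<otimes> e j) n \<preceq> x j"
          proof (rule big_join_least)
            fix i assume "i < n"
            then show "x i \<otimes> e j \<preceq> x j" using diag off[of i] xc[OF j] by (cases "i = j") auto
          qed (use xc ec j in auto)
          moreover have "x j \<preceq> rl_big_join A (\<lambda>i. x i \<otimes> e j) n"
            using big_join_upper[of n "\<lambda>i. x i \<otimes> e j" j] xc ec j diag by simp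
          ultimately have "rl_big_join A (\<lambda>i. x i \<otimes> e j) n = x j"
            using le_antisym xc ec j by simp
          then show ?thesis using big_join_mult[of n x "e j"] xc ec j by simp
        qed
        then have "x = ?h (rl_big_join A x n)"
          using x by (auto simp: rl_product_def PiE_def extensional_def fun_eq_iff)
        then show "x \<in> ?h ` carrier A" using xc by (intro image_eqI) auto
      qed
    qed
  qed
  moreover have "?h \<zero> = \<zero>\<^bsub>?P\<^esub>" "?h \<one> = \<one>\<^bsub>?P\<^esub>"
    using ec by (auto simp: rl_product_def)
  moreover have "?h (a \<curlyvee> b) = ?h a \<curlyvee>\<^bsub>?P\<^esub> ?h b \<and> ?h (a \<curlywedge> b) = ?h a \<curlywedge>\<^bsub>?P\<^esub> ?h b \<and>
      ?h (a \<otimes> b) = ?h a \<otimes>\<^bsub>?P\<^esub> ?h b \<and> ?h (a \<rightharpoonup> b) = ?h a \<rightharpoonup>\<^bsub>?P\<^esub> ?h b"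
    if c: "a \<in> carrier A" "b \<in> carrier A" for a b
  proof -
    \<comment> \<open>In general \<open>\<otimes>\<close> does not distribute over
      \<open>\<curlywedge>\<close>. Here the meet on the right lies below \<open>e i\<close>, so
      multiplying it by \<open>e i\<close> changes nothing.\<close>
    have "(a \<curlywedge> b) \<otimes> e i = (a \<otimes> e i) \<curlywedge> (b \<otimes> e i)" if i: "i < n" for i
    proof (rule le_antisym)
      have "((a \<otimes> e i) \<curlywedge> (b \<otimes> e i)) \<otimes> e i = (a \<otimes> e i) \<curlywedge> (b \<otimes> e i)"
        using c ec i by (intro Boolean_center_absorb e) (simp_all add: meet_le)
      moreover have "((a \<otimes> e i) \<curlywedge> (b \<otimes> e i)) \<otimes> e i \<preceq> (a \<curlywedge> b) \<otimes> e i"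
        using c ec i le_trans[of "(a \<otimes> e i) \<curlywedge> (b \<otimes> e i)" "a \<otimes> e i" a]
          le_trans[of "(a \<otimes> e i) \<curlywedge> (b \<otimes> e i)" "b \<otimes> e i" b]
        by (intro mult_mono_left) simp_all
      ultimately show "(a \<otimes> e i) \<curlywedge> (b \<otimes> e i) \<preceq> (a \<curlywedge> b) \<otimes> e i" by simp
    qed (use c ec i in \<open>simp_all add: mult_mono_left\<close>)
    moreover have "(a \<otimes> b) \<otimes> e i = (a \<otimes> e i) \<otimes> (b \<otimes> e i)" if i: "i < n" for i
    proof -
      have "(a \<otimes> e i) \<otimes> (b \<otimes> e i) = (a \<otimes> b) \<otimes> (e i \<otimes> e i)" using c ec i by (simp add: m_ac)
      then show ?thesis using e i by (simp add: Boolean_center_idem)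
    qed
    ultimately show ?thesis
      using c ec e by (auto simp: rl_product_def mult_join_distrib Boolean_center_mult_imp)
  qed
  ultimately have "?h \<in> rl_iso A ?P" by (simp add: rl_iso_def)
  then show ?thesis unfolding rl_isomorphic_def by blast
qed

end

section \<open>Assembling the local factors from the Boolean isolating elements\<close>

theorem theorem6p6:
  fixes A :: "'a reslat"
  assumes "residuated_lattice A"
    and "rl_nontrivial A"
    and "rl_lifting_Boolean_center A"
    and "rl_maximal A"
  shows "\<exists>(n :: nat) (B :: nat \<Rightarrow> 'a reslat).
    (\<forall>i<n. residuated_lattice (B i) \<and> rl_local (B i) \<and> rl_maximal (B i)) \<and>
    rl_isomorphic A (rl_product {..<n} B)"
proof -
  interpret residuated_lattice A by fact
  let ?Max = "{M. rl_maximal_filter A M}"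
  obtain M n where bij: "bij_betw M {..<n::nat} ?Max"
    using ex_bij_betw_nat_finite[OF finite_maximal_filters[OF assms(4)]]
    by (auto simp: atLeast0LessThan)
  have M: "rl_maximal_filter A (M i)" if "i < n" for i
    using bij_betwE[OF bij] that by auto
  have enum: "\<exists>i<n. N = M i" if "rl_maximal_filter A N" for N
    using bij_betw_imp_surj_on[OF bij] that by auto
  have distinct: "M i \<noteq> M j" if "i < n" "j < n" "i \<noteq> j" for i j
    using bij_betw_imp_inj_on[OF bij] that by (auto dest: inj_onD)
  have "\<forall>i\<in>{..<n}. \<exists>f. f \<in> rl_Boolean_center A \<and> f \<in> M i \<and>
      (\<forall>N. rl_maximal_filter A N \<and> N \<noteq> M i \<longrightarrow> f \<rightharpoonup>\<^bsub>A\<^esub> \<zero>\<^bsub>A\<^esub> \<in> N)"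
    using Boolean_isolating[OF assms(4,3)] M by blast
  then obtain e where e: "\<And>i. i < n \<Longrightarrow> e i \<in> rl_Boolean_center A"
    and eM: "\<And>i. i < n \<Longrightarrow> e i \<in> M i"
    and neg: "\<And>i N. i < n \<Longrightarrow> rl_maximal_filter A N \<Longrightarrow> N \<noteq> M i
      \<Longrightarrow> e i \<rightharpoonup>\<^bsub>A\<^esub> \<zero>\<^bsub>A\<^esub> \<in> N"
    using bchoice[of "{..<n}"] by (metis lessThan_iff)
  \<comment> \<open>This serves two purposes: a maximal filter containing \<open>e i\<close> and
    \<open>e j\<close> would be both \<open>M i\<close> and \<open>M j\<close>, which forces
    disjointness, and each interval has just one candidate for its maximal filter.\<close>
  have unique: "N = M i" if "i < n" "rl_maximal_filter A N" "e i \<in> N" for i N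
    using neg maximal_filter_neg that by blast
  have ec: "e i \<in> carrier A" if "i < n" for i using e that Boolean_center_carrier by blast
  have disjoint: "e i \<otimes>\<^bsub>A\<^esub> e j = \<zero>\<^bsub>A\<^esub>" if ij: "i < n" "j < n" "i \<noteq> j" for i j
  proof (rule idempotent_eq_zero)
    have "(e i \<otimes>\<^bsub>A\<^esub> e j) \<otimes>\<^bsub>A\<^esub> (e i \<otimes>\<^bsub>A\<^esub> e j) =
        (e i \<otimes>\<^bsub>A\<^esub> e i) \<otimes>\<^bsub>A\<^esub> (e j \<otimes>\<^bsub>A\<^esub> e j)"
      using ec ij by (simp add: m_ac)
    then show "(e i \<otimes>\<^bsub>A\<^esub> e j) \<otimes>\<^bsub>A\<^esub> (e i \<otimes>\<^bsub>A\<^esub> e j) = e i \<otimes>\<^bsub>A\<^esub> e j"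
      using e ij by (simp add: Boolean_center_idem)
    fix N assume N: "rl_maximal_filter A N"
    show "e i \<otimes>\<^bsub>A\<^esub> e j \<notin> N"
    proof
      assume "e i \<otimes>\<^bsub>A\<^esub> e j \<in> N"
      then have "e i \<in> N" "e j \<in> N"
        using filter_up[OF maximal_filterD(1)[OF N], of "e i \<otimes>\<^bsub>A\<^esub> e j"] ec ij by simp_all
      then have "N = M i" "N = M j" using unique N ij by blast+
      then show False using distinct ij by blast
    qed
  qed (use ec ij in auto)
  have "rl_big_join A e n = \<one>\<^bsub>A\<^esub>"
  proof (rule Boolean_center_eq_one)
    show "rl_big_join A e n \<in> rl_Boolean_center A" using e by (rule big_join_Boolean_center)
    fix N assume N: "rl_maximal_filter A N"
    then obtain i where "i < n" "N = M i" using enum by blast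
    then show "rl_big_join A e n \<in> N"
      using filter_up[OF maximal_filterD(1)[OF N] _ big_join_upper[of n e i]] eM ec by simp
  qed
  then have "rl_isomorphic A (rl_product {..<n} (\<lambda>i. rl_interval A (e i)))"
    using partition_of_unity_isomorphic e disjoint by blast
  moreover have "residuated_lattice (rl_interval A (e i)) \<and> rl_local (rl_interval A (e i)) \<and>
      rl_maximal (rl_interval A (e i))" if "i < n" for i
    using interval_residuated_lattice interval_maximal[OF _ assms(4)]
      interval_local[OF e[OF that] M[OF that] eM[OF that] unique[OF that]] e that by blast
  ultimately show ?thesis by (intro exI[of _ n] exI[of _ "\<lambda>i. rl_interval A (e i)"]) blast
qed

end
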